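(* If $a$ is a product (concatenation) of pyramids, then for every integer $k\ge 1$, $$ f(d u^k a) = \zeta^{k+1}\big(a,\, u^{|a|}\big). $$
   Context: A (binary) path of length $n$ is a lattice path $P=p_1\cdots p_n$ starting at the origin, each step being an upstep $u=(1,1)$ or a downstep $d=(1,-1)$; $|P|=n$ is its length, $\mathcal{P}_n$ the set of paths of length $n$, $\mathcal{P}=\bigcup_{n\ge0}\mathcal{P}_n$, and $[k]=\{1,\dots,k\}$. $\mathcal{P}_n$ is ordered by $P\le Q$ iff $P$ lies weakly below $Q$ (at each abscissa the height, i.e. $y$-coordinate, of $P$ is at most that of $Q$); its maximum is $\mathbf{1}_n=u^n$. A valley of $P$ is the last point of a maximal run of $d$'s: it is either the middle point of an occurrence of $du$, or the endpoint of $P$ when $P$ ends with $d$. Turning a valley into a peak means replacing the corresponding $du$ by $ud$ (or, for a valley at the end of the path, the final $d$ by $u$). The filling of $P$ is the path $\widetilde P$ obtained by turning every valley of $P$ into a peak (so $\widetilde{\mathbf 1_n}=\mathbf 1_n$). Put $P^{(0)}=P$, $P^{(i)}=\widetilde{P^{(i-1)}}$; the degree $\delta(P)$ is the least $k\ge0$ with $P^{(k)}=\mathbf 1_{|P|}$. A chain $P_0\le P_1\le\cdots\le P_k$ (of length $k$) has small intervals if for each $i\in[k]$ the path $P_i$ is obtained from $P_{i-1}$ by turning some valleys of $P_{i-1}$ into peaks (equivalently $P_{i-1}\le P_i\le\widetilde{P_{i-1}}$). $f(P)$ is the number of chains of length $\delta(P)$ with small intervals from $P$ to $\mathbf 1_{|P|}$.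 A pyramid is a path of the form $u^m d^m$, $m\ge0$. $\zeta$ is the zeta function of the poset $\mathcal{P}$ ($\zeta(x,y)=1$ if $x\le y$ and $0$ otherwise), and its powers are convolution powers in the incidence algebra, so that $\zeta^{k}(x,y)$ is the number of multichains $x=x_0\le x_1\le\cdots\le x_k=y$ of length $k$. *)

theory Defs
  imports Main
begin

datatype step = Up | Down

type_synonym path = "step list"

fun step_val :: "step \<Rightarrow> int" where
  "step_val Up = 1"
| "step_val Down = - 1"

definition height :: "path \<Rightarrow> nat \<Rightarrow> int" where
  "height P i = (\<Sum>s\<leftarrow>take i P. step_val s)"

text \<open>Paths of different lengths are incomparable: the poset of all paths is the disjoint union
  of the posets of paths of a fixed length.\<close>

definition weakly_below :: "path \<Rightarrow> path \<Rightarrow> bool"  (infix "\<preceq>" 50) where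
  "P \<preceq> Q \<longleftrightarrow> length P = length Q \<and> (\<forall>i\<le>length P. height P i \<le> height Q i)"

definition top_path :: "nat \<Rightarrow> path" where
  "top_path n = replicate n Up"

text \<open>A valley is identified by its abscissa \<open>v\<close>. The step ending at abscissa \<open>v\<close> is \<open>P ! (v - 1)\<close>
  and the step starting there, if there is one, is \<open>P ! v\<close>.\<close>

definition valleys :: "path \<Rightarrow> nat set" where
  "valleys P = {v \<in> {1..length P}. P ! (v - 1) = Down \<and> (v < length P \<longrightarrow> P ! v = Up)}"

text \<open>For a set \<open>S\<close> of valleys of \<open>P\<close>: each step ending at a point of \<open>S\<close> becomes an upstep and each
  step starting at a point of \<open>S\<close> becomes a downstep. No step does both, since it would have to be
  both an upstep and a downstep of \<open>P\<close>.\<close>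

definition turn_valleys :: "path \<Rightarrow> nat set \<Rightarrow> path" where
  "turn_valleys P S =
     map (\<lambda>i. if Suc i \<in> S then Up else if i \<in> S then Down else P ! i) [0..<length P]"

definition filling :: "path \<Rightarrow> path" where
  "filling P = turn_valleys P (valleys P)"

definition degree :: "path \<Rightarrow> nat" where
  "degree P = (LEAST k. (filling ^^ k) P = top_path (length P))"

definition small_interval :: "path \<Rightarrow> path \<Rightarrow> bool" where
  "small_interval P Q \<longleftrightarrow> (\<exists>S \<subseteq> valleys P. Q = turn_valleys P S)"

text \<open>A chain \<open>P\<^sub>0 \<preceq> \<dots> \<preceq> P\<^sub>k\<close> (repetitions allowed) is the list of its \<open>k + 1\<close> members.\<close>

definition small_chains :: "nat \<Rightarrow> path \<Rightarrow> path \<Rightarrow> path list set" where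
  "small_chains k P Q = {c. length c = k + 1 \<and> c ! 0 = P \<and> c ! k = Q \<and>
     (\<forall>i<k. c ! i \<preceq> c ! Suc i \<and> small_interval (c ! i) (c ! Suc i))}"

definition num_small_chains :: "path \<Rightarrow> nat" where
  "num_small_chains P = card (small_chains (degree P) P (top_path (length P)))"

definition pyramid :: "path \<Rightarrow> bool" where
  "pyramid P \<longleftrightarrow> (\<exists>m. P = replicate m Up @ replicate m Down)"

definition pyramid_product :: "path \<Rightarrow> bool" where
  "pyramid_product P \<longleftrightarrow> (\<exists>ps. (\<forall>p \<in> set ps. pyramid p) \<and> P = concat ps)"

type_synonym incidence = "path \<Rightarrow> path \<Rightarrow> int"

definition inc_unit :: incidence where
  "inc_unit x y = (if x = y then 1 else 0)"

definition conv :: "incidence \<Rightarrow> incidence \<Rightarrow> incidence" where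
  "conv F G x y = (\<Sum>z | x \<preceq> z \<and> z \<preceq> y. F x z * G z y)"

primrec conv_power :: "incidence \<Rightarrow> nat \<Rightarrow> incidence" where
  "conv_power F 0 = inc_unit"
| "conv_power F (Suc n) = conv (conv_power F n) F"

definition zeta :: incidence where
  "zeta x y = (if x \<preceq> y then 1 else 0)"

text \<open>The sums in \<open>conv\<close> and the cardinality in \<open>num_small_chains\<close> are over finite sets, so neither
  takes its default value.\<close>

lemma finite_paths: "finite {P :: path. length P = n}"
proof -
  have "finite (UNIV :: step set)"
    by (rule finite_subset [of _ "{Up, Down}"]) (use step.exhaust in auto)
  then show ?thesis
    using finite_lists_length_eq [of UNIV n] by simp
qed

lemma finite_interval: "finite {z. x \<preceq> z \<and> z \<preceq> y}"
  by (rule finite_subset [OF _ finite_paths [of "length y"]]) (auto simp: weakly_below_def)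

lemma finite_small_chains: "finite (small_chains k P Q)"
proof -
  have len: "length (c ! i) = length P" if "c \<in> small_chains k P Q" "i \<le> k" for c i
    using that(2)
  proof (induction i)
    case 0
    then show ?case using that(1) by (simp add: small_chains_def)
  next
    case (Suc i)
    then show ?case using that(1) by (auto simp: small_chains_def weakly_below_def)
  qed
  have "small_chains k P Q \<subseteq> {c. set c \<subseteq> {R. length R = length P} \<and> length c = k + 1}"
    using len by (auto simp: in_set_conv_nth) (auto simp: small_chains_def)
  then show ?thesis
    by (rule finite_subset) (rule finite_lists_length_eq [OF finite_paths])
qed

end

theory Submission imports Defs begin

text \<open>
  Chains are extended to families of paths indexed by all integer times, constant before the first
  and after the last member, and a path is encoded by the number of downsteps in each prefix.
  Since no downstep of \<open>d u\<^sup>k a\<close> starts below the axis, repeated filling never blocks the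
  first downstep. Hence the degree is the length \<open>|a| + k + 1\<close>, and in a chain of that length the first downstep has to move at
  every step.

  For each family of paths take the set of points \<open>(v, h, t)\<close> such that the path at time \<open>t\<close>
  has height at least \<open>h\<close> at abscissa \<open>v\<close>. Small intervals mean that \<open>(v, h, t)\<close> in this set
  forces \<open>(v \<plusminus> 1, h - 1, t - 1)\<close> to be in it, while for a multichain it forces \<open>(v \<plusminus> 1, h - 1, t)\<close>;
  in both cases the set is closed under increasing \<open>t\<close>. The shear \<open>t \<mapsto> t - h\<close>, up to a
  translation, exchanges the two conditions. It matches the boundary values too because all
  valleys of \<open>a\<close> lie on the axis.
\<close>


section \<open>Paths and their down counts\<close>

text \<open>Unlike heights, down counts carry no parity condition: paths of length \<open>n\<close>
  correspond to the natural sequences starting at 0 with increments 0 or 1. The order is reversed,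
  so a higher path has smaller counts.\<close>

definition downs :: "path \<Rightarrow> nat \<Rightarrow> nat" where
  "downs P v = count_list (take v P) Down"

lemma downs_0 [simp]: "downs P 0 = 0"
  by (simp add: downs_def)

lemma downs_Suc:
  "v < length P \<Longrightarrow> downs P (Suc v) = downs P v + (if P ! v = Down then 1 else 0)"
  by (simp add: downs_def take_Suc_conv_app_nth)

lemma downs_le: "downs P v \<le> v"
  by (metis count_le_length downs_def length_take min.cobounded2 order_trans)

lemma downs_append:
  "downs (P @ Q) v = downs P v + downs Q (v - length P)"
  by (simp add: downs_def)

lemma downs_Cons: "downs (s # P) (Suc v) = (if s = Down then 1 else 0) + downs P v"
  by (simp add: downs_def)

lemma downs_replicate_Up [simp]: "downs (replicate m Up) v = 0"
  by (simp add: downs_def count_list_0_iff)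

lemma downs_replicate_Down: "downs (replicate m Down) v = min v m"
  by (induction m arbitrary: v) (auto simp: downs_def take_Cons' gr0_conv_Suc)

lemma height_eq_downs: "v \<le> length P \<Longrightarrow> height P v = int v - 2 * int (downs P v)"
proof (induction v)
  case 0
  then show ?case by (simp add: height_def)
next
  case (Suc v)
  then have "height P (Suc v) = height P v + step_val (P ! v)"
    by (simp add: height_def take_Suc_conv_app_nth)
  with Suc show ?case by (cases "P ! v") (auto simp: downs_Suc)
qed

lemma weakly_below_downs:
  "P \<preceq> Q \<longleftrightarrow> length P = length Q \<and> (\<forall>v\<le>length P. downs Q v \<le> downs P v)"
  by (auto simp: weakly_below_def height_eq_downs)

lemma weakly_below_refl: "P \<preceq> P"
  by (simp add: weakly_below_def)

lemma weakly_below_trans: "P \<preceq> Q \<Longrightarrow> Q \<preceq> R \<Longrightarrow> P \<preceq> R"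
  unfolding weakly_below_def by (metis order_trans)

lemma path_eqI:
  assumes "length P = length Q" "\<And>v. v \<le> length P \<Longrightarrow> downs P v = downs Q v"
  shows "P = Q"
proof (rule nth_equalityI)
  show "P ! v = Q ! v" if "v < length P" for v
    using downs_Suc[of v P] downs_Suc[of v Q] assms(1) assms(2)[of v] assms(2)[of "Suc v"] that
    by (cases "P ! v"; cases "Q ! v") auto
qed (fact assms(1))

lemma path_of_downs:
  fixes d :: "nat \<Rightarrow> nat"
  assumes "d 0 = 0" "\<And>v. v < n \<Longrightarrow> d v \<le> d (Suc v)" "\<And>v. v < n \<Longrightarrow> d (Suc v) \<le> Suc (d v)"
  shows "\<exists>P. length P = n \<and> (\<forall>v\<le>n. downs P v = d v)"
proof (intro exI conjI allI impI)
  let ?P = "map (\<lambda>v. if d (Suc v) = d v then Up else Down) [0..<n]"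
  show "length ?P = n" by simp
  show "downs ?P v = d v" if "v \<le> n" for v
    using that
  proof (induction v)
    case (Suc v)
    then show ?case using assms(2)[of v] assms(3)[of v] by (auto simp: downs_Suc)
  qed (simp add: assms(1))
qed

lemma length_top_path [simp]: "length (top_path n) = n"
  by (simp add: top_path_def)

lemma downs_top_path [simp]: "downs (top_path n) v = 0"
  by (simp add: top_path_def)

section \<open>Turning valleys, small steps and filling in terms of down counts\<close>

lemma length_turn_valleys [simp]: "length (turn_valleys P S) = length P"
  by (simp add: turn_valleys_def)

lemma valleys_step_before: "Suc v \<in> S \<Longrightarrow> S \<subseteq> valleys P \<Longrightarrow> P ! v = Down"
  by (drule (1) subsetD[rotated]) (simp add: valleys_def)

lemma valleys_step_after: "v \<in> S \<Longrightarrow> S \<subseteq> valleys P \<Longrightarrow> v < length P \<Longrightarrow> P ! v = Up"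
  by (drule (1) subsetD[rotated]) (simp add: valleys_def)

lemma downs_turn_valleys:
  assumes "S \<subseteq> valleys P" "v \<le> length P"
  shows "downs P v = downs (turn_valleys P S) v + (if v \<in> S then 1 else 0)"
  using assms(2)
proof (induction v)
  case 0
  have "0 \<notin> S" using assms(1) by (auto simp: valleys_def)
  then show ?case by simp
next
  case (Suc v)
  have nth: "turn_valleys P S ! v = (if Suc v \<in> S then Up else if v \<in> S then Down else P ! v)"
    using Suc.prems by (simp add: turn_valleys_def)
  have "Suc v \<in> S \<Longrightarrow> P ! v = Down" "v \<in> S \<Longrightarrow> P ! v = Up"
    using Suc.prems assms(1) valleys_step_before valleys_step_after by auto
  with Suc nth show ?case by (auto simp: downs_Suc)
qed

definition small_step :: "path \<Rightarrow> path \<Rightarrow> bool" where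
  "small_step P Q \<longleftrightarrow> P \<preceq> Q \<and> small_interval P Q"

text \<open>In heights, the two inequalities say that \<open>Q\<close> exceeds \<open>P\<close> at a
  neighbouring abscissa by at most 1. Hence where \<open>Q\<close> is strictly above
  \<open>P\<close>, the existing neighbours in \<open>P\<close> are higher, so \<open>P\<close> has
  a valley there, and the rise is exactly 2.\<close>

lemma small_step_iff:
  "small_step P Q \<longleftrightarrow> P \<preceq> Q \<and>
     (\<forall>v<length P. downs P v \<le> downs Q (Suc v) \<and> downs P (Suc v) \<le> Suc (downs Q v))"
  (is "_ \<longleftrightarrow> _ \<and> ?small")
proof (intro iffI conjI)
  assume step: "small_step P Q"
  then show "P \<preceq> Q" by (simp add: small_step_def)
  from step obtain S where S: "S \<subseteq> valleys P" "Q = turn_valleys P S"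
    by (auto simp: small_step_def small_interval_def)
  show ?small
  proof (intro allI impI)
    fix v assume v: "v < length P"
    have "Suc v \<in> S \<Longrightarrow> P ! v = Down" "v \<in> S \<Longrightarrow> P ! v = Up"
      using v S(1) valleys_step_before valleys_step_after by auto
    moreover have "downs P v = downs Q v + (if v \<in> S then 1 else 0)"
      "downs P (Suc v) = downs Q (Suc v) + (if Suc v \<in> S then 1 else 0)"
      using v S downs_turn_valleys by auto
    ultimately show "downs P v \<le> downs Q (Suc v) \<and> downs P (Suc v) \<le> Suc (downs Q v)"
      using downs_Suc[OF v] by (cases "v \<in> S"; cases "Suc v \<in> S"; cases "P ! v") simp_all
  qed
next
  assume asm: "P \<preceq> Q \<and> ?small"
  then have len: "length Q = length P" and le: "\<And>v. v \<le> length P \<Longrightarrow> downs Q v \<le> downs P v"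
    by (auto simp: weakly_below_downs)
  \<comment> \<open>The turned valleys are recovered as the abscissae where \<open>Q\<close> is
    strictly higher.\<close>
  define S where "S = {v. v \<le> length P \<and> downs Q v < downs P v}"
  have sub: "S \<subseteq> valleys P"
  proof
    fix v assume "v \<in> S"
    then have v: "v \<le> length P" "downs Q v < downs P v" by (auto simp: S_def)
    then have "v \<noteq> 0" by (metis downs_0 less_irrefl)
    then obtain u where u: "v = Suc u" by (cases v) auto
    have "downs P u \<le> downs Q v" using asm u v by auto
    then have "P ! u = Down" using downs_Suc[of u P] u v by (auto split: if_splits)
    moreover have "P ! v = Up" if "v < length P"
    proof -
      have "downs P (Suc v) \<le> Suc (downs Q v)" using asm that by auto
      with v(2) downs_Suc[OF that] show ?thesis by (cases "P ! v") auto
    qed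
    ultimately show "v \<in> valleys P" using u v by (auto simp: valleys_def)
  qed
  have "Q = turn_valleys P S"
  proof (rule path_eqI)
    fix v assume "v \<le> length Q"
    then have v: "v \<le> length P" using len by simp
    have "downs P v \<le> Suc (downs Q v)"
    proof (cases v)
      case (Suc u)
      then have "downs P u \<le> downs Q v" using asm v by auto
      then show ?thesis using downs_Suc[of u P] Suc v by (auto split: if_splits)
    qed simp
    then have "downs P v = downs Q v + (if v \<in> S then 1 else 0)"
      using v le[OF v] by (simp add: S_def)
    then show "downs Q v = downs (turn_valleys P S) v"
      using downs_turn_valleys[OF sub v] by simp
  qed (simp add: len)
  with sub asm show "small_step P Q"
    by (auto simp: small_step_def small_interval_def)
qed

lemma small_step_refl: "small_step P P"
  by (auto simp: small_step_iff weakly_below_refl downs_Suc)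

lemma length_filling [simp]: "length (filling P) = length P"
  by (simp add: filling_def)

lemma small_step_filling: "small_step P (filling P)"
proof -
  have "P \<preceq> filling P"
    using downs_turn_valleys[of "valleys P" P]
    by (auto simp: weakly_below_downs filling_def)
  then show ?thesis by (auto simp: small_step_def small_interval_def filling_def)
qed

text \<open>Away from the origin, the filling is at least one higher than \<open>P\<close> at some
  neighbouring abscissa: a point that is no valley already has a lower neighbour, and a valley is
  lifted above its neighbours.\<close>

lemma downs_filling_le:
  assumes "v < length P"
  shows "downs (filling P) (Suc v) \<le> downs P v \<or>
    (Suc v < length P \<and> Suc (downs (filling P) (Suc v)) \<le> downs P (Suc (Suc v)))"
proof -
  have eq: "downs P (Suc v) = downs (filling P) (Suc v) + (if Suc v \<in> valleys P then 1 else 0)"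
    unfolding filling_def using assms by (intro downs_turn_valleys) auto
  show ?thesis
  proof (cases "Suc v \<in> valleys P")
    case True
    then show ?thesis using eq assms by (auto simp: downs_Suc split: if_splits)
  next
    case False
    then consider "P ! v = Up" | "Suc v < length P" "P ! Suc v = Down"
      using assms by (cases "P ! v"; cases "P ! Suc v") (auto simp: valleys_def)
    then show ?thesis using eq False assms by cases (auto simp: downs_Suc)
  qed
qed

section \<open>Chains as families of paths indexed by the integers\<close>

definition chain_lists :: "(path \<Rightarrow> path \<Rightarrow> bool) \<Rightarrow> nat \<Rightarrow> path \<Rightarrow> path \<Rightarrow> path list set" where
  "chain_lists r k P Q = {c. length c = k + 1 \<and> c ! 0 = P \<and> c ! k = Q \<and> (\<forall>i<k. r (c ! i) (c ! Suc i))}"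

text \<open>The shear moves times by amounts depending on the height, so it leaves the range from 0
  to \<open>k\<close>; constant values outside spare a separate treatment of the ends.\<close>

definition families :: "(path \<Rightarrow> path \<Rightarrow> bool) \<Rightarrow> nat \<Rightarrow> path \<Rightarrow> path \<Rightarrow> (int \<Rightarrow> path) set" where
  "families r k P Q = {p. (\<forall>t\<le>0. p t = P) \<and> (\<forall>t\<ge>int k. p t = Q) \<and> (\<forall>t. r (p t) (p (t + 1)))}"

lemma card_chain_lists_eq_families:
  assumes refl: "\<And>P. r P P"
  shows "card (chain_lists r k P Q) = card (families r k P Q)"
proof -
  \<comment> \<open>\<open>min k (nat t)\<close> clamps \<open>t\<close> to the range from 0 to
    \<open>k\<close>, since \<open>nat\<close> sends negative integers to 0.\<close>
  define extend where "extend c t = (c :: path list) ! min k (nat t)" for c t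
  define restrict where "restrict p = map (\<lambda>i. p (int i) :: path) [0..<k + 1]" for p
  have nth: "restrict p ! i = p (int i)" if "i \<le> k" for p i
    unfolding restrict_def using that by (subst nth_map) (auto simp del: upt_Suc)
  have len: "length (restrict p) = k + 1" for p
    by (simp add: restrict_def)
  have "bij_betw extend (chain_lists r k P Q) (families r k P Q)"
  proof (rule bij_betw_byWitness[where f' = restrict])
    show "\<forall>c\<in>chain_lists r k P Q. restrict (extend c) = c"
    proof
      fix c assume "c \<in> chain_lists r k P Q"
      then have "length c = k + 1" by (simp add: chain_lists_def)
      then show "restrict (extend c) = c"
        by (intro nth_equalityI) (simp_all add: nth extend_def len)
    qed
    show "\<forall>p\<in>families r k P Q. extend (restrict p) = p"
    proof (intro ballI ext)
      fix p t assume p: "p \<in> families r k P Q"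
      have "extend (restrict p) t = p (int (min k (nat t)))"
        by (simp add: extend_def nth)
      also have "\<dots> = p t"
        using p by (cases "t \<le> 0"; cases "t \<ge> int k") (auto simp: families_def min_def)
      finally show "extend (restrict p) t = p t" .
    qed
    show "extend ` chain_lists r k P Q \<subseteq> families r k P Q"
    proof clarify
      fix c assume c: "c \<in> chain_lists r k P Q"
      have "r (extend c t) (extend c (t + 1))" for t
      proof (cases "0 \<le> t \<and> t < int k")
        case True
        then have "min k (nat t) = nat t" "min k (nat (t + 1)) = Suc (nat t)" "nat t < k" by auto
        then show ?thesis using c by (simp add: extend_def chain_lists_def)
      next
        case False
        then have "min k (nat (t + 1)) = min k (nat t)" by auto
        then show ?thesis by (simp add: extend_def refl)
      qed
      then show "extend c \<in> families r k P Q"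
        using c by (auto simp: families_def chain_lists_def extend_def min_def)
    qed
    show "restrict ` families r k P Q \<subseteq> chain_lists r k P Q"
    proof clarify
      fix p assume p: "p \<in> families r k P Q"
      then have "r (p (int i)) (p (int (Suc i)))" for i
        by (simp add: families_def add.commute[of 1])
      with p show "restrict p \<in> chain_lists r k P Q"
        by (auto simp: chain_lists_def nth families_def len)
    qed
  qed
  then show ?thesis by (rule bij_betw_same_card)
qed

lemma families_weakly_below:
  assumes p: "p \<in> families r k P Q" and r: "\<And>P Q. r P Q \<Longrightarrow> P \<preceq> Q"
  shows "length (p t) = length P"
    and "s \<le> t \<Longrightarrow> v \<le> length P \<Longrightarrow> downs (p t) v \<le> downs (p s) v"
proof -
  have step: "p t \<preceq> p (t + 1)" for t using p r by (auto simp: families_def)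
  have le: "p s \<preceq> p t" if "s \<le> t" for s t
    using that by (induction t rule: int_ge_induct)
      (auto intro: weakly_below_refl weakly_below_trans step)
  have "p (min 0 t) \<preceq> p t" for t by (intro le) auto
  moreover have "p (min 0 t) = P" for t using p by (simp add: families_def)
  ultimately show len: "length (p t) = length P" for t
    by (metis weakly_below_def)
  show "downs (p t) v \<le> downs (p s) v" if "s \<le> t" "v \<le> length P"
    using le[OF that(1)] that(2) len[of s] by (auto simp: weakly_below_downs)
qed

section \<open>Powers of the zeta function count multichains\<close>

lemma finite_chain_lists_weakly_below: "finite (chain_lists (\<preceq>) k P Q)"
proof -
  have len: "length (c ! i) = length P" if "c \<in> chain_lists (\<preceq>) k P Q" "i \<le> k" for c i
    using that(2,1) by (induction i) (auto simp: chain_lists_def weakly_below_def)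
  have "chain_lists (\<preceq>) k P Q \<subseteq> {c. set c \<subseteq> {R. length R = length P} \<and> length c = k + 1}"
    using len by (auto simp: in_set_conv_nth) (auto simp: chain_lists_def)
  then show ?thesis
    by (rule finite_subset) (rule finite_lists_length_eq [OF finite_paths])
qed

text \<open>Splitting off the last member matches the recursion of \<open>conv_power\<close>, which
  multiplies by the new factor on the right.\<close>

lemma chain_lists_Suc:
  "chain_lists r (Suc k) P Q = (\<Union>R\<in>{R. r R Q}. (\<lambda>c. c @ [Q]) ` chain_lists r k P R)"
proof (intro equalityI subsetI)
  fix c assume c: "c \<in> chain_lists r (Suc k) P Q"
  then have len: "length c = Suc (Suc k)" by (simp add: chain_lists_def)
  then have eq: "c = take (Suc k) c @ [Q]"
    using c take_Suc_conv_app_nth[of "Suc k" c] by (simp add: chain_lists_def)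
  have "take (Suc k) c \<in> chain_lists r k P (c ! k)" "r (c ! k) Q"
    using c by (auto simp: chain_lists_def)
  with eq show "c \<in> (\<Union>R\<in>{R. r R Q}. (\<lambda>c. c @ [Q]) ` chain_lists r k P R)" by blast
next
  fix c assume "c \<in> (\<Union>R\<in>{R. r R Q}. (\<lambda>c. c @ [Q]) ` chain_lists r k P R)"
  then show "c \<in> chain_lists r (Suc k) P Q"
    by (auto simp: chain_lists_def nth_append less_Suc_eq)
qed

lemma chain_lists_weakly_below_imp: "c \<in> chain_lists (\<preceq>) k P Q \<Longrightarrow> P \<preceq> Q"
  by (induction k arbitrary: c Q)
    (auto simp: chain_lists_Suc intro: weakly_below_trans, auto simp: chain_lists_def weakly_below_refl)

lemma conv_power_zeta: "conv_power zeta k P Q = int (card (chain_lists (\<preceq>) k P Q))"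
proof (induction k arbitrary: Q)
  case 0
  have "chain_lists (\<preceq>) 0 P Q = (if P = Q then {[P]} else {})"
    by (auto simp: chain_lists_def length_Suc_conv)
  then show ?case by (simp add: inc_unit_def)
next
  case (Suc k)
  let ?I = "{R. P \<preceq> R \<and> R \<preceq> Q}"
  \<comment> \<open>There is no multichain from \<open>P\<close> to \<open>R\<close> unless
    \<open>P \<preceq> R\<close>, so the union shrinks to the interval over which
    \<open>conv\<close> sums.\<close>
  have "chain_lists (\<preceq>) (Suc k) P Q = (\<Union>R\<in>?I. (\<lambda>c. c @ [Q]) ` chain_lists (\<preceq>) k P R)"
    unfolding chain_lists_Suc using chain_lists_weakly_below_imp by blast
  also have "card \<dots> = (\<Sum>R\<in>?I. card ((\<lambda>c. c @ [Q]) ` chain_lists (\<preceq>) k P R))"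
    by (rule card_UN_disjoint)
      (auto simp: finite_interval finite_chain_lists_weakly_below, auto simp: chain_lists_def)
  also have "\<dots> = (\<Sum>R\<in>?I. card (chain_lists (\<preceq>) k P R))"
    by (intro sum.cong card_image) (auto simp: inj_on_def)
  finally have "int (card (chain_lists (\<preceq>) (Suc k) P Q)) =
      (\<Sum>R\<in>?I. int (card (chain_lists (\<preceq>) k P R)))"
    by simp
  also have "\<dots> = (\<Sum>R\<in>?I. conv_power zeta k P R * zeta R Q)"
    by (intro sum.cong) (auto simp: Suc zeta_def)
  finally show ?case by (simp add: conv_def)
qed

lemma num_small_chains_eq:
  "num_small_chains P = card (families small_step (degree P) P (top_path (length P)))"
proof -
  have "small_chains k P Q = chain_lists small_step k P Q" for k P Q
    by (auto simp: small_chains_def chain_lists_def small_step_def)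
  then show ?thesis
    by (simp add: num_small_chains_def card_chain_lists_eq_families small_step_refl)
qed

section \<open>Degree\<close>

lemma length_filling_pow [simp]: "length ((filling ^^ t) P) = length P"
  by (induction t) auto

text \<open>In heights: a path that never goes below -1 has height at least
  \<open>min v (t - 1)\<close> (over the integers) after \<open>t\<close> fillings, as each filling
  puts every point but the origin one above some former neighbour. The truncated subtraction encodes
  the minimum.\<close>

lemma downs_filling_pow_le:
  assumes "\<And>v. v \<le> length P \<Longrightarrow> 2 * downs P v \<le> Suc v" "v \<le> length P"
  shows "2 * downs ((filling ^^ t) P) v \<le> Suc v - t"
  using assms(2)
proof (induction t arbitrary: v)
  case 0
  then show ?case using assms(1) by simp
next
  case (Suc t)
  show ?case
  proof (cases v)
    case 0
    then show ?thesis by simp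
  next
    case (Suc u)
    then show ?thesis
      using Suc.prems Suc.IH[of u] Suc.IH[of "Suc v"] downs_filling_le[of u "(filling ^^ t) P"]
      by fastforce
  qed
qed

text \<open>Downsteps are not lost but pushed right, by at most one abscissa per filling.\<close>

lemma downs_filling_pow_ge:
  assumes "v \<le> length P"
  shows "v + t \<le> length P \<Longrightarrow> downs P v \<le> downs ((filling ^^ t) P) (v + t)"
proof (induction t)
  case (Suc t)
  have "small_step ((filling ^^ t) P) ((filling ^^ Suc t) P)"
    by (simp add: small_step_filling)
  then show ?case using Suc by (auto simp: small_step_iff intro: order_trans)
qed simp

text \<open>The initial downstep needs one filling per abscissa to leave at the right end, and by
  the height bound that many fillings also suffice.\<close>

lemma degree_Cons_Down:
  assumes "\<And>v. v \<le> length (Down # P) \<Longrightarrow> 2 * downs (Down # P) v \<le> Suc v"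
  shows "degree (Down # P) = length (Down # P)" (is "degree ?P = _")
  unfolding degree_def
proof (rule Least_equality)
  show "(filling ^^ length ?P) ?P = top_path (length ?P)"
  proof (rule path_eqI)
    fix v assume "v \<le> length ((filling ^^ length ?P) ?P)"
    then have v: "v \<le> length ?P" by (simp only: length_filling_pow)
    have "2 * downs ((filling ^^ length ?P) ?P) v \<le> Suc v - length ?P"
      by (rule downs_filling_pow_le[OF assms v])
    also have "\<dots> \<le> 1" using v by simp
    finally show "downs ((filling ^^ length ?P) ?P) v = downs (top_path (length ?P)) v"
      by simp
  qed (simp only: length_filling_pow length_top_path)
  fix t assume top: "(filling ^^ t) ?P = top_path (length ?P)"
  show "length ?P \<le> t"
  proof (rule ccontr)
    assume "\<not> length ?P \<le> t"
    then have "downs ?P 1 \<le> downs ((filling ^^ t) ?P) (1 + t)"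
      by (intro downs_filling_pow_ge) auto
    then show False by (simp add: top downs_Cons)
  qed
qed

section \<open>Products of pyramids\<close>

text \<open>Valleys occur only where pyramids meet or end, hence on the axis. So heights are
  nonnegative, and every point off the axis follows an upstep or precedes a downstep.\<close>

lemma downs_pyramid_product:
  assumes "pyramid_product a"
  shows "v \<le> length a \<Longrightarrow> 2 * downs a v \<le> v"
    and "v \<le> length a \<Longrightarrow> 2 * downs a v = v \<or> (\<exists>u. v = Suc u \<and> downs a u = downs a v)
           \<or> (v < length a \<and> downs a (Suc v) = Suc (downs a v))"
proof -
  \<comment> \<open>Ending on the axis is added so that the property is preserved by
    concatenation.\<close>
  define good where "good a \<longleftrightarrow> 2 * downs a (length a) = length a \<and> (\<forall>v\<le>length a. 2 * downs a v \<le> v \<and>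
     (2 * downs a v = v \<or> (\<exists>u. v = Suc u \<and> downs a u = downs a v)
           \<or> (v < length a \<and> downs a (Suc v) = Suc (downs a v))))" for a
  have pyr: "good (replicate m Up @ replicate m Down)" for m
  proof -
    have d: "downs (replicate m Up @ replicate m Down) v = min m (v - m)" for v
      by (simp add: downs_append downs_replicate_Down)
    have "2 * min m (v - m) = v \<or> (\<exists>u. v = Suc u \<and> min m (u - m) = min m (v - m)) \<or>
        (v < m + m \<and> min m (Suc v - m) = Suc (min m (v - m)))" if "v \<le> m + m" for v
    proof (cases "v \<le> m")
      case True
      then show ?thesis by (cases v) auto
    qed (use that in auto)
    then show ?thesis by (auto simp: good_def d)
  qed
  have app: "good (p @ q)" if p: "good p" and q: "good q" for p q
    unfolding good_def
  proof (intro conjI allI impI)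
    have full: "downs p (length p + w) = downs p (length p)" for w
      by (simp add: downs_def)
    show "2 * downs (p @ q) (length (p @ q)) = length (p @ q)"
      using p q full[of "length q"] by (auto simp: good_def downs_append)
    fix v assume v: "v \<le> length (p @ q)"
    consider "v < length p" | w where "v = length p + w" "w \<le> length q"
      using v by (cases "v < length p") (auto simp: le_iff_add not_less)
    note vcases = this
    show "2 * downs (p @ q) v \<le> v"
    proof (cases rule: vcases)
      case 1
      then show ?thesis using p by (simp add: good_def downs_append)
    next
      case (2 w)
      then have "2 * downs p (length p) = length p" "2 * downs q w \<le> w"
        using p q by (simp_all add: good_def)
      then show ?thesis using 2(1) full[of w] by (simp add: downs_append)
    qed
    show "2 * downs (p @ q) v = v \<or> (\<exists>u. v = Suc u \<and> downs (p @ q) u = downs (p @ q) v)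
           \<or> (v < length (p @ q) \<and> downs (p @ q) (Suc v) = Suc (downs (p @ q) v))"
    proof (cases rule: vcases)
      case 1
      then consider "2 * downs p v = v" | u where "v = Suc u" "downs p u = downs p v"
        | "downs p (Suc v) = Suc (downs p v)"
        using p unfolding good_def by (meson less_imp_le)
      then show ?thesis using 1 by cases (auto simp: downs_append)
    next
      case (2 w)
      have "2 * downs p (length p) = length p" using p by (simp add: good_def)
      have "downs (p @ q) (length p + x) = downs p (length p) + downs q x" for x
        using full[of x] by (simp add: downs_append)
      note shift = this this[of "Suc w", unfolded add_Suc_right]
      consider "2 * downs q w = w" | u where "w = Suc u" "downs q u = downs q w"
        | "w < length q" "downs q (Suc w) = Suc (downs q w)"
        using q 2(2) unfolding good_def by blast
      then show ?thesis
      proof cases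
        case 1
        then show ?thesis using 2(1) \<open>2 * downs p (length p) = length p\<close> by (simp add: shift)
      next
        case (2 u)
        have "v = Suc (length p + u)" using \<open>v = length p + w\<close> 2(1) by simp
        moreover have "downs (p @ q) (length p + u) = downs (p @ q) v"
          unfolding \<open>v = length p + w\<close> shift(1) 2(2) ..
        ultimately show ?thesis by blast
      next
        case 3
        then show ?thesis using 2(1) by (simp add: shift)
      qed
    qed
  qed
  have "good a"
  proof -
    obtain ps where ps: "\<forall>p\<in>set ps. pyramid p" "a = concat ps"
      using assms by (auto simp: pyramid_product_def)
    have "good (concat ps)" using ps(1)
    proof (induction ps)
      case Nil
      then show ?case by (simp add: good_def)
    next
      case (Cons p ps)
      then show ?case using pyr app by (auto simp: pyramid_def)
    qed
    then show ?thesis using ps by simp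
  qed
  then show "v \<le> length a \<Longrightarrow> 2 * downs a v \<le> v"
    and "v \<le> length a \<Longrightarrow> 2 * downs a v = v \<or> (\<exists>u. v = Suc u \<and> downs a u = downs a v)
           \<or> (v < length a \<and> downs a (Suc v) = Suc (downs a v))"
    unfolding good_def by blast+
qed

lemma downs_prefix_le:
  "v \<le> Suc k \<Longrightarrow> downs (Down # replicate k Up @ a) v = min 1 v"
  by (cases v) (simp_all add: downs_Cons downs_append)

lemma downs_prefix_add:
  "downs (Down # replicate k Up @ a) (w + k + 1) = Suc (downs a w)"
  by (simp add: downs_Cons downs_append)

section \<open>The correspondence between the two kinds of families\<close>

text \<open>The relation is required for all paths with the prescribed counts because the paths
  themselves are chosen only inside the proof.\<close>

lemma family_of_downs:
  fixes d :: "int \<Rightarrow> nat \<Rightarrow> nat"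
  assumes "length Q = length P"
    and "\<And>t. d t 0 = 0"
    and "\<And>t v. v < length P \<Longrightarrow> d t v \<le> d t (Suc v)"
    and "\<And>t v. v < length P \<Longrightarrow> d t (Suc v) \<le> Suc (d t v)"
    and "\<And>t v. t \<le> 0 \<Longrightarrow> v \<le> length P \<Longrightarrow> d t v = downs P v"
    and "\<And>t v. t \<ge> int k \<Longrightarrow> v \<le> length P \<Longrightarrow> d t v = downs Q v"
    and r: "\<And>t R S. length R = length P \<Longrightarrow> length S = length P \<Longrightarrow>
      (\<And>v. v \<le> length P \<Longrightarrow> downs R v = d t v) \<Longrightarrow>
      (\<And>v. v \<le> length P \<Longrightarrow> downs S v = d (t + 1) v) \<Longrightarrow> r R S"
  shows "\<exists>p\<in>families r k P Q. \<forall>t. \<forall>v\<le>length P. downs (p t) v = d t v"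
proof -
  have "\<forall>t. \<exists>R. length R = length P \<and> (\<forall>v\<le>length P. downs R v = d t v)"
    using assms by (intro allI path_of_downs) auto
  then obtain p where p: "\<And>t. length (p t) = length P"
      "\<And>t v. v \<le> length P \<Longrightarrow> downs (p t) v = d t v"
    by metis
  have "p t = P" if "t \<le> 0" for t
    using that p assms by (intro path_eqI) auto
  moreover have "p t = Q" if "t \<ge> int k" for t
    using that p assms by (intro path_eqI) auto
  moreover have "r (p t) (p (t + 1))" for t
    by (rule r[of _ _ t]) (auto simp: p)
  ultimately have "p \<in> families r k P Q" by (auto simp: families_def)
  with p show ?thesis by blast
qed

lemma family_eqI:
  assumes "p \<in> families r k P Q" "q \<in> families r k P Q" "\<And>P Q. r P Q \<Longrightarrow> P \<preceq> Q"
    and "\<And>t v. v \<le> length P \<Longrightarrow> downs (p t) v = downs (q t) v"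
  shows "p = q"
  using families_weakly_below(1)[OF assms(1,3)] families_weakly_below(1)[OF assms(2,3)] assms(4)
  by (intro ext path_eqI) auto

lemma eq_if_same_bounds:
  fixes x y :: nat
  assumes "\<And>j. x \<le> j \<longleftrightarrow> y \<le> j"
  shows "x = y"
  using assms[of x] assms[of y] by auto

text \<open>Allows \<open>interlaced\<close> to serve as a bijection without composing two explicit
  inverse maps.\<close>

lemma card_eq_correspondence:
  assumes "\<And>x. x \<in> A \<Longrightarrow> \<exists>y\<in>B. r x y"
    and "\<And>y. y \<in> B \<Longrightarrow> \<exists>x\<in>A. r x y"
    and "\<And>x x' y. x \<in> A \<Longrightarrow> x' \<in> A \<Longrightarrow> y \<in> B \<Longrightarrow> r x y \<Longrightarrow> r x' y \<Longrightarrow> x = x'"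
    and "\<And>x y y'. x \<in> A \<Longrightarrow> y \<in> B \<Longrightarrow> y' \<in> B \<Longrightarrow> r x y \<Longrightarrow> r x y' \<Longrightarrow> y = y'"
  shows "card A = card B"
proof -
  obtain f where f: "\<And>x. x \<in> A \<Longrightarrow> f x \<in> B \<and> r x (f x)"
    using assms(1) by metis
  have "inj_on f A"
    by (rule inj_onI) (metis f assms(3))
  moreover have "f ` A = B"
  proof
    show "f ` A \<subseteq> B" using f by auto
    show "B \<subseteq> f ` A"
    proof
      fix y assume y: "y \<in> B"
      then obtain x where x: "x \<in> A" "r x y" using assms(2) by metis
      then have "f x = y" using f[of x] y assms(4) by metis
      with x show "y \<in> f ` A" by blast
    qed
  qed
  ultimately have "bij_betw f A B" by (simp add: bij_betw_def)
  then show ?thesis by (rule bij_betw_same_card)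
qed

text \<open>The shear between the two kinds of families. The first downstep of \<open>d u\<^sup>k a\<close> accounts for
  the difference between \<open>Suc j\<close> and \<open>j\<close>, the prefix \<open>d u\<^sup>k\<close> for the abscissa
  \<open>w + k + 1\<close>. Substituting the height \<open>h = w + k + 1 - 2 (j + 1)\<close> turns the time of \<open>q\<close> into
  \<open>t - h + k + 1\<close>.\<close>

definition interlaced :: "nat \<Rightarrow> nat \<Rightarrow> (int \<Rightarrow> path) \<Rightarrow> (int \<Rightarrow> path) \<Rightarrow> bool" where
  "interlaced k n p q \<longleftrightarrow> (\<forall>t w j. w \<le> n \<longrightarrow>
     (downs (p t) (w + k + 1) \<le> Suc j \<longleftrightarrow> downs (q (t + 2 - int w + 2 * int j)) w \<le> j))"

section \<open>From small families to multichain families\<close>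

context
  fixes a :: path and k :: nat and p :: "int \<Rightarrow> path"
  assumes p: "p \<in> families small_step (length a + k + 1) (Down # replicate k Up @ a)
    (top_path (length a + k + 1))"
begin

lemma small_family_mono:
  "s \<le> t \<Longrightarrow> v \<le> length a + k + 1 \<Longrightarrow> downs (p t) v \<le> downs (p s) v"
  using families_weakly_below(2)[OF p] by (simp add: small_step_def)

lemma small_family_step:
  assumes "v \<le> length a + k"
  shows "downs (p t) v \<le> downs (p (t + 1)) (Suc v)"
    and "downs (p t) (Suc v) \<le> Suc (downs (p (t + 1)) v)"
proof -
  have "length (p t) = length a + k + 1"
    using families_weakly_below(1)[OF p] by (simp add: small_step_def)
  moreover have "small_step (p t) (p (t + 1))"
    using p by (simp add: families_def)
  ultimately show "downs (p t) v \<le> downs (p (t + 1)) (Suc v)"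
    "downs (p t) (Suc v) \<le> Suc (downs (p (t + 1)) v)"
    using assms by (auto simp: small_step_iff)
qed

lemma small_family_nonpos: "t \<le> 0 \<Longrightarrow> p t = Down # replicate k Up @ a"
  using p by (simp add: families_def)

lemma small_family_steps:
  "v + m \<le> length a + k + 1 \<Longrightarrow> downs (p t) v \<le> downs (p (t + int m)) (v + m)"
proof (induction m)
  case (Suc m)
  then have "downs (p t) v \<le> downs (p (t + int m)) (v + m)" by simp
  also have "\<dots> \<le> downs (p (t + int m + 1)) (Suc (v + m))"
    using Suc.prems by (intro small_family_step) simp
  finally show ?case by (simp add: ac_simps)
qed simp

text \<open>The total time equals the length, so there is no slack. A downstep left in the prefix
  \<open>v\<close> at a time \<open>t\<close> with \<open>v \<le> t\<close> would survive at the
  right end when the top path is due; before time \<open>v\<close>, the initial downstep cannot yet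
  have left that prefix.\<close>

lemma small_family_eq_0_iff:
  assumes "v \<le> length a + k + 1"
  shows "downs (p t) v = 0 \<longleftrightarrow> int v \<le> t \<or> v = 0"
proof (cases "int v \<le> t")
  case True
  define m where "m = length a + k + 1 - v"
  have m: "length a + k + 1 = v + m" using assms by (simp add: m_def)
  have "downs (p t) v \<le> downs (p (t + int m)) (v + m)"
    using small_family_steps[of v m t] m by simp
  also have "p (t + int m) = top_path (length a + k + 1)"
    using p True m by (auto simp: families_def)
  finally show ?thesis using True by simp
next
  case False
  show ?thesis
  proof (cases v)
    case (Suc u)
    have "downs (p (t - int u)) 1 \<le> downs (p (t - int u + int u)) (1 + u)"
      using assms Suc small_family_steps[of 1 u "t - int u"] by simp
    moreover have "downs (p (t - int u)) 1 = 1"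
      using False Suc by (simp add: small_family_nonpos downs_Cons)
    ultimately show ?thesis using False Suc by auto
  qed simp
qed

lemma small_family_prefix:
  assumes "v \<le> Suc k"
  shows "downs (p t) v \<le> 1"
proof -
  have "downs (p t) v \<le> downs (p (min 0 t)) v"
    using assms by (intro small_family_mono) auto
  also have "\<dots> \<le> 1" using assms by (simp add: small_family_nonpos downs_prefix_le)
  finally show ?thesis .
qed

text \<open>A raised point is no valley at the next step, so two consecutive steps raise an abscissa
  at most once.\<close>

lemma small_family_back_two:
  "v \<le> length a + k + 1 \<Longrightarrow> downs (p (t - 2)) v \<le> Suc (downs (p t) v)"
proof (cases v)
  case (Suc u)
  assume "v \<le> length a + k + 1"
  then show ?thesis
    using small_family_step(2)[of u "t - 2"] small_family_step(1)[of u "t - 1"] Suc by simp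
qed simp

text \<open>In terms of heights, with \<open>H\<^sub>t\<close> the height function of \<open>p t\<close>: the bound is
  \<open>H\<^sub>t(v) \<le> max (H\<^sub>0(v)) (t + k)\<close>. It survives a step because every point of \<open>a\<close> off the ground
  has a neighbour below it, so that only ground points can be raised above it.\<close>

lemma small_family_lower_bound:
  assumes a: "pyramid_product a" and "w \<le> length a"
  shows "Suc (downs a w) \<le> downs (p (int t)) (w + k + 1) \<or>
    w + 1 \<le> t + 2 * downs (p (int t)) (w + k + 1)"
  using assms(2)
proof (induction t arbitrary: w)
  case 0
  have "downs (p (int 0)) (w + k + 1) = Suc (downs a w)"
    by (simp only: of_nat_0 small_family_nonpos order_refl downs_prefix_add)
  then show ?case by simp
next
  case (Suc t)
  show ?case
  proof (cases w)
    case (Suc u)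
    have left: "downs (p (int t)) (u + k + 1) \<le> downs (p (int (Suc t))) (w + k + 1)"
      using small_family_step(1)[of "u + k + 1" "int t"] Suc Suc.prems by (simp add: ac_simps)
    note IH = Suc.IH[of u]
    consider "2 * downs a w = w" | "downs a u = downs a w"
      | "w < length a" "downs a (Suc w) = Suc (downs a w)"
      using downs_pyramid_product(2)[OF a, of w] Suc Suc.prems by auto
    then show ?thesis
    proof cases
      case 1
      \<comment> \<open>The left neighbour of a ground point starts at height at most
        \<open>k\<close> in the whole path, so by induction it is at most \<open>t + k\<close> at
        time \<open>t\<close>; the ground point is then at most \<open>t + k + 1\<close> one step
        later.\<close>
      have "downs a w \<le> Suc (downs a u)"
        using downs_Suc[of u a] Suc Suc.prems by simp
      then show ?thesis using 1 left IH Suc Suc.prems by auto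
    next
      case 2
      then show ?thesis using left IH Suc Suc.prems by auto
    next
      case 3
      have "downs (p (int t)) (Suc w + k + 1) \<le> Suc (downs (p (int (Suc t))) (w + k + 1))"
        using small_family_step(2)[of "w + k + 1" "int t"] 3 by (simp add: ac_simps)
      then show ?thesis using 3 Suc.IH[of "Suc w"] by auto
    qed
  qed simp
qed

lemma small_family_imp_multichain_family:
  assumes a: "pyramid_product a"
  shows "\<exists>q\<in>families (\<preceq>) (k + 1) a (top_path (length a)). interlaced k (length a) p q"
proof -
  \<comment> \<open>The interlacing condition, with \<open>i = t + 2 - w + 2 j\<close> solved for
    \<open>t\<close>; the least \<open>j\<close> satisfying it is the down count that
    \<open>q\<close> must have.\<close>
  define D where "D i w j \<longleftrightarrow> downs (p (i - 2 + int w - 2 * int j)) (w + k + 1) \<le> Suc j" for i w j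
  define d where "d i w = (LEAST j. D i w j)" for i w
  have up: "D i w (Suc j)" if "D i w j" "w \<le> length a" for i w j
    using that small_family_back_two[of "w + k + 1" "i - 2 + int w - 2 * int j"]
    by (simp add: D_def algebra_simps)
have nonpos: "D i w j" if "downs a w \<le> j" "w \<le> length a" for i w j
  proof -
    let ?t = "i - 2 + int w - 2 * int j"
    have "downs (p ?t) (w + k + 1) \<le> downs (p (min 0 ?t)) (w + k + 1)"
      using that by (intro small_family_mono) auto
    also have "\<dots> = Suc (downs a w)" by (simp only: small_family_nonpos downs_prefix_add min.cobounded1)
    finally show ?thesis using that by (simp add: D_def)
  qed
  have d: "d i w \<le> j \<longleftrightarrow> D i w j" if "w \<le> length a" for i w j
  proof
    assume "d i w \<le> j"
    then show "D i w j"
    proof (induction j rule: dec_induct)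
      case base
      \<comment> \<open>The witness is \<open>j = w\<close>, by
        \<open>downs a w \<le> w\<close>.\<close>
      show ?case unfolding d_def using nonpos[OF downs_le that] by (rule LeastI)
    qed (use up that in auto)
  qed (simp add: d_def Least_le)
  have "\<exists>q\<in>families (\<preceq>) (k + 1) a (top_path (length a)).
      \<forall>i. \<forall>w\<le>length a. downs (q i) w = d i w"
  proof (rule family_of_downs)
    show "d i 0 = 0" for i
    proof -
      have "D i 0 0" using small_family_prefix[of "Suc k"] by (simp add: D_def)
      then show ?thesis using d[of 0 i 0] by simp
    qed
    show "d i w \<le> d i (Suc w)" if w: "w < length a" for i w
    proof -
      \<comment> \<open>For fixed \<open>i\<close>, moving from \<open>D i (Suc w) j\<close> to
        \<open>D i w j\<close> shifts the time of \<open>p\<close> back by one, so a small-step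
        inequality of \<open>p\<close> becomes a condition for \<open>q i\<close> to be a path. The
        next bound works likewise.\<close>
      let ?j = "d i (Suc w)"
      have "D i (Suc w) ?j" using d[of "Suc w"] w by auto
      then have "D i w ?j"
        using small_family_step(1)[of "w + k + 1" "i - 2 + int w - 2 * int ?j"] w
        by (simp add: D_def algebra_simps)
      then show ?thesis using d w by simp
    qed
    show "d i (Suc w) \<le> Suc (d i w)" if w: "w < length a" for i w
    proof -
      let ?j = "d i w"
      have "D i w ?j" using d[of w] w by auto
      then have "D i (Suc w) (Suc ?j)"
        using small_family_step(2)[of "w + k + 1" "i - 3 + int w - 2 * int ?j"] w
        by (simp add: D_def algebra_simps)
      then show ?thesis using d w by simp
    qed
    show "d i w = downs a w" if i: "i \<le> 0" and w: "w \<le> length a" for i w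
    proof (rule eq_if_same_bounds)
      fix j
      have "downs a w \<le> j" if "D i w j"
      proof (cases "i - 2 + int w - 2 * int j \<le> 0")
        case True
        then show ?thesis
          using that unfolding D_def small_family_nonpos[OF True] downs_prefix_add by simp
      next
        case False
        then obtain t where t: "i - 2 + int w - 2 * int j = int t"
          by (metis nat_0_le not_le less_imp_le)
        \<comment> \<open>The second alternative of the lower bound would give
          \<open>w + 1 \<le> i + w\<close>, which \<open>i \<le> 0\<close> excludes.\<close>
        then show ?thesis
          using small_family_lower_bound[OF a w, of t] that i by (auto simp: D_def)
      qed
      then show "d i w \<le> j \<longleftrightarrow> downs a w \<le> j" using d nonpos w by blast
    qed
    show "d i w = downs (top_path (length a)) w" if i: "i \<ge> int (k + 1)" and w: "w \<le> length a" for i w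
    proof -
      let ?v = "w + k + 1"
      \<comment> \<open>The prefix \<open>?v\<close> is free of downsteps at time \<open>?v\<close>,
        so two steps earlier it has at most one, which is what \<open>D i w 0\<close>
        demands.\<close>
      have "downs (p (i - 2 + int w)) ?v \<le> downs (p (int ?v - 2)) ?v"
        using i w by (intro small_family_mono) auto
      also have "\<dots> \<le> Suc (downs (p (int ?v)) ?v)"
        using w by (intro small_family_back_two) auto
      also have "downs (p (int ?v)) ?v = 0"
        using w by (subst small_family_eq_0_iff) auto
      finally have "D i w 0" by (simp add: D_def)
      then show ?thesis using d[of w i 0] w by simp
    qed
    show "R \<preceq> S" if "length R = length a" "length S = length a"
      "\<And>w. w \<le> length a \<Longrightarrow> downs R w = d i w" "\<And>w. w \<le> length a \<Longrightarrow> downs S w = d (i + 1) w" for i R S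
    proof -
      have "d (i + 1) w \<le> d i w" if w: "w \<le> length a" for w
      proof -
        have "D i w (d i w)" using d w by blast
        moreover have "downs (p (i + 1 - 2 + int w - 2 * int (d i w))) (w + k + 1)
            \<le> downs (p (i - 2 + int w - 2 * int (d i w))) (w + k + 1)"
          using w by (intro small_family_mono) auto
        ultimately have "D (i + 1) w (d i w)" unfolding D_def by (rule order_trans[rotated])
        then show ?thesis using d w by blast
      qed
      then show ?thesis using that by (auto simp: weakly_below_downs)
    qed
  qed simp
  then obtain q where q: "q \<in> families (\<preceq>) (k + 1) a (top_path (length a))"
    and qd: "\<And>i w. w \<le> length a \<Longrightarrow> downs (q i) w = d i w"
    by blast
  have "interlaced k (length a) p q"
    by (auto simp: interlaced_def qd d D_def)
  with q show ?thesis by blast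
qed

end

section \<open>From multichain families back to small families\<close>

lemma multichain_family_imp_small_family:
  assumes a: "pyramid_product a"
    and q: "q \<in> families (\<preceq>) (k + 1) a (top_path (length a))"
  shows "\<exists>p\<in>families small_step (length a + k + 1) (Down # replicate k Up @ a)
    (top_path (length a + k + 1)). interlaced k (length a) p q"
proof -
  let ?P = "Down # replicate k Up @ a" and ?n = "length a"
  have mono: "downs (q i) w \<le> downs (q h) w" if "h \<le> i" "w \<le> ?n" for h i w
    using families_weakly_below(2)[OF q] that by simp
  have up: "downs (q i) w \<le> downs (q i) (Suc w)" "downs (q i) (Suc w) \<le> Suc (downs (q i) w)"
    if "w < ?n" for i w
    using families_weakly_below(1)[OF q] that by (auto simp: downs_Suc)
  have q_nonpos: "q i = a" if "i \<le> 0" for i using q that by (simp add: families_def)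
  have q_top: "downs (q i) w = 0" if "i \<ge> int k + 1" for i w
    using q that by (simp add: families_def)
  define D where "D t w j \<longleftrightarrow> downs (q (t + 2 - int w + 2 * int j)) w \<le> j" for t w j
  \<comment> \<open>Interlacing only tests thresholds \<open>Suc j\<close> at abscissae beyond
    \<open>k\<close>. The value 0 is therefore put in by hand, at the times dictated by the motion
    of the first downstep, and the count on the prefix up to \<open>k\<close> is otherwise
    1.\<close>
  define d where "d t v = (if int v \<le> t \<or> v = 0 then 0 else if v \<le> k then 1
    else Suc (LEAST j. D t (v - Suc k) j))" for t v
  have D_mono: "D t w j" if "D s w i" "i \<le> j" "s \<le> t" "w \<le> ?n" for s t w i j
    using mono[of "s + 2 - int w + 2 * int i" "t + 2 - int w + 2 * int j" w] that
    by (simp add: D_def)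
  have d_Suc: "d t (w + k + 1) \<le> Suc j \<longleftrightarrow> D t w j" if w: "w \<le> ?n" for t w j
  proof (cases "int (w + k + 1) \<le> t")
    case True
    then show ?thesis using q_top[of "t + 2 - int w + 2 * int j" w] by (simp add: d_def D_def)
  next
    case False
    have "D t w (LEAST j. D t w j)"
      by (rule LeastI[of _ w]) (simp add: D_def downs_le)
    then have "(LEAST j. D t w j) \<le> j \<longleftrightarrow> D t w j"
      using D_mono[OF _ _ order_refl w] Least_le by blast
    then show ?thesis using False by (simp add: d_def)
  qed
  have d_0: "d t v = 0 \<longleftrightarrow> int v \<le> t \<or> v = 0" for t v
    by (simp add: d_def)
  have d_le_1: "d t v \<le> 1" if "v \<le> Suc k" for t v
  proof (cases "v = Suc k")
    case True
    then show ?thesis using d_Suc[of 0 t 0] by (simp add: D_def)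
  qed (use that in \<open>simp add: d_def\<close>)
  have vcases: "v \<le> k \<or> (\<exists>w\<le>?n. v = w + k + 1)" if "v \<le> length ?P" for v
    using that by (cases "v \<le> k") (auto intro!: exI[of _ "v - Suc k"])
  have dec: "d t v \<le> d s v" if st: "s \<le> t" and v: "v \<le> length ?P" for s t v
  proof -
    consider "v \<le> k" | w where "w \<le> ?n" "v = w + k + 1" using vcases[OF v] by auto
    then show ?thesis
    proof cases
      case 1
      then show ?thesis using st by (auto simp: d_def)
    next
      case (2 w)
      show ?thesis
      proof (cases "d s v")
        case 0
        then show ?thesis using d_0[of s v] d_0[of t v] st by auto
      next
        case (Suc j)
        then have "D s w j" using d_Suc[OF 2(1), of s j] 2(2) by simp
        then have "D t w j" by (rule D_mono[OF _ order_refl st 2(1)])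
        then show ?thesis using d_Suc[OF 2(1), of t j] 2(2) Suc by simp
      qed
    qed
  qed
  have step1: "d t v \<le> d (t + 1) (Suc v)" if v: "v < length ?P" for t v
  proof (cases "d (t + 1) (Suc v)")
    case 0
    then show ?thesis using d_0[of "t + 1" "Suc v"] d_0[of t v] by simp
  next
    case (Suc j)
    consider "v \<le> k" | w where "w < ?n" "v = w + k + 1" using vcases[of v] v by auto
    then show ?thesis
    proof cases
      case 1
      then show ?thesis using d_le_1[of v t] Suc by simp
    next
      case (2 w)
      then have "D (t + 1) (Suc w) j" using d_Suc[of "Suc w" "t + 1" j] Suc by simp
      \<comment> \<open>Both conditions evaluate \<open>q\<close> at the same time, so this compares
        neighbouring prefixes of one path.\<close>
      then have "D t w j"
        using up(1)[OF 2(1), of "t + 2 - int w + 2 * int j"] by (simp add: D_def algebra_simps)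
      then show ?thesis using d_Suc[of w t j] 2 Suc by simp
    qed
  qed
  have step2: "d t (Suc v) \<le> Suc (d (t + 1) v)" if v: "v < length ?P" for t v
  proof -
    consider "v \<le> k" | w where "w < ?n" "v = w + k + 1" using vcases[of v] v by auto
    then show ?thesis
    proof cases
      case 1
      then show ?thesis using d_le_1[of "Suc v" t] by simp
    next
      case (2 w)
      have "D t (Suc w) (d (t + 1) v)"
      proof (cases "d (t + 1) v")
        case 0
        \<comment> \<open>Hence \<open>t + 1 - w\<close>, the time at which
          \<open>D t (Suc w) 0\<close> evaluates \<open>q\<close>, is at least \<open>k + 1\<close>,
          just late enough for the top path.\<close>
        then have "int v \<le> t + 1" using d_0[of "t + 1" v] 2 by simp
        then show ?thesis using 0 2 by (simp add: D_def q_top)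
      next
        case (Suc j)
        then have "D (t + 1) w j" using d_Suc[of w "t + 1" j] 2 by simp
        then show ?thesis
          using up(2)[OF 2(1), of "t + 3 - int w + 2 * int j"] Suc by (simp add: D_def algebra_simps)
      qed
      then show ?thesis using d_Suc[of "Suc w" t] 2 by simp
    qed
  qed
  have "\<exists>p\<in>families small_step (?n + k + 1) ?P (top_path (?n + k + 1)).
      \<forall>t. \<forall>v\<le>length ?P. downs (p t) v = d t v"
  proof (rule family_of_downs)
    show "d t 0 = 0" for t by (simp add: d_def)
    show "d t v \<le> d t (Suc v)" if "v < length ?P" for t v
      using step1[OF that, of t] dec[of t "t + 1" "Suc v"] that by (simp del: of_nat_Suc)
    show "d t (Suc v) \<le> Suc (d t v)" if "v < length ?P" for t v
      using step2[OF that, of t] dec[of t "t + 1" v] that by simp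
    show "d t v = downs ?P v" if t: "t \<le> 0" and v: "v \<le> length ?P" for t v
      using vcases[OF v]
    proof (elim disjE exE conjE)
      assume "v \<le> k"
      then show ?thesis using t by (auto simp: d_def downs_prefix_le simp del: append.simps)
    next
      fix w assume w: "w \<le> ?n" "v = w + k + 1"
      have "D t w j \<longleftrightarrow> downs a w \<le> j" for j
      proof (cases "t + 2 - int w + 2 * int j \<le> 0")
        case True
        then show ?thesis by (simp add: D_def q_nonpos)
      next
        case False
        \<comment> \<open>A positive time of \<open>q\<close> with \<open>t \<le> 0\<close> forces
          \<open>w < 2 j + 2\<close>; since \<open>a\<close> stays above or on the axis, both sides
          of the equivalence hold.\<close>
        have "downs a w \<le> j"
          using downs_pyramid_product(1)[OF a w(1)] False t by simp
        moreover have "downs (q (t + 2 - int w + 2 * int j)) w \<le> downs (q 0) w"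
          using False w by (intro mono) auto
        ultimately show ?thesis by (simp add: D_def q_nonpos)
      qed
      then have "d t v \<le> m \<longleftrightarrow> Suc (downs a w) \<le> m" for m
        using d_Suc[OF w(1), of t] d_0[of t v] t w by (cases m) auto
      then have "d t v = Suc (downs a w)" by (rule eq_if_same_bounds)
      then show ?thesis unfolding w(2) downs_prefix_add .
    qed
    show "d t v = downs (top_path (?n + k + 1)) v"
      if "t \<ge> int (?n + k + 1)" "v \<le> length ?P" for t v
      using that by (auto simp: d_def)
    show "small_step R S" if "length R = length ?P" "length S = length ?P"
      "\<And>v. v \<le> length ?P \<Longrightarrow> downs R v = d t v"
      "\<And>v. v \<le> length ?P \<Longrightarrow> downs S v = d (t + 1) v" for t R S
      unfolding small_step_iff weakly_below_downs
      using that dec[of t "t + 1"] step1 step2 by (auto simp del: length_Cons)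
  qed simp
  then obtain p where p: "p \<in> families small_step (?n + k + 1) ?P (top_path (?n + k + 1))"
    and pd: "\<And>t v. v \<le> length ?P \<Longrightarrow> downs (p t) v = d t v"
    by blast
  have "interlaced k ?n p q"
    unfolding interlaced_def
  proof (intro allI impI)
    fix t w j assume w: "w \<le> ?n"
    then show "downs (p t) (w + k + 1) \<le> Suc j \<longleftrightarrow> downs (q (t + 2 - int w + 2 * int j)) w \<le> j"
      using d_Suc[OF w, of t j] by (simp add: pd D_def)
  qed
  with p show ?thesis by blast
qed

lemma card_small_families_eq:
  assumes a: "pyramid_product a"
  shows "card (families small_step (length a + k + 1) (Down # replicate k Up @ a)
      (top_path (length a + k + 1))) = card (families (\<preceq>) (k + 1) a (top_path (length a)))"
    (is "card ?A = card ?B")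
proof (rule card_eq_correspondence)
  show "\<exists>q\<in>?B. interlaced k (length a) p q" if "p \<in> ?A" for p
    using small_family_imp_multichain_family[OF that a] .
  show "\<exists>p\<in>?A. interlaced k (length a) p q" if "q \<in> ?B" for q
    using multichain_family_imp_small_family[OF a that] .
  show "q = q'" if "q \<in> ?B" "q' \<in> ?B"
    and i: "interlaced k (length a) p q" "interlaced k (length a) p q'" for p q q'
  proof (rule family_eqI[OF that(1,2)])
    fix i w assume w: "w \<le> length a"
    show "downs (q i) w = downs (q' i) w"
    proof (rule eq_if_same_bounds)
      fix j
      have "i = (i - 2 + int w - 2 * int j) + 2 - int w + 2 * int j" by simp
      then show "downs (q i) w \<le> j \<longleftrightarrow> downs (q' i) w \<le> j"
        using i w unfolding interlaced_def by metis
    qed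
  qed
  show "p = p'" if p: "p \<in> ?A" "p' \<in> ?A"
    and i: "interlaced k (length a) p q" "interlaced k (length a) p' q" for p p' q
  proof (rule family_eqI[OF p])
    fix t v assume v: "v \<le> length (Down # replicate k Up @ a)"
    show "downs (p t) v = downs (p' t) v"
    proof (rule eq_if_same_bounds)
      fix m
      \<comment> \<open>Threshold 0, invisible to interlacing, is the same for all small
        families.\<close>
      have 0: "downs (p t) v = 0 \<longleftrightarrow> downs (p' t) v = 0"
        using small_family_eq_0_iff[OF p(1)] small_family_eq_0_iff[OF p(2)] v by simp
      show "downs (p t) v \<le> m \<longleftrightarrow> downs (p' t) v \<le> m"
      proof (cases m)
        case (Suc j)
        show ?thesis
        proof (cases "v \<le> k")
          case True
          then show ?thesis
            using small_family_prefix[OF p(1), of v t] small_family_prefix[OF p(2), of v t] Suc by simp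
        next
          case False
          then obtain w where "v = w + k + 1"
            using le_Suc_ex[of "Suc k" v] by (auto simp: not_less_eq_eq ac_simps)
          then show ?thesis using i v Suc by (auto simp: interlaced_def)
        qed
      qed (use 0 in simp)
    qed
  qed (simp add: small_step_def)
qed

theorem corollary19:
  fixes a :: path and k :: nat
  assumes "pyramid_product a" and "k \<ge> 1"
  shows "int (num_small_chains (Down # replicate k Up @ a)) =
           conv_power zeta (k + 1) a (top_path (length a))"
proof -
  let ?P = "Down # replicate k Up @ a"
  \<comment> \<open>The path never goes below -1: the first downstep reaches -1, and
    \<open>a\<close> runs on or above height \<open>k - 1\<close>.\<close>
  have "2 * downs ?P v \<le> Suc v" if v: "v \<le> length ?P" for v
  proof (cases "v \<le> Suc k")
    case True
    then show ?thesis by (simp add: downs_prefix_le del: append.simps)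
  next
    case False
    then obtain w where w: "v = w + k + 1"
      using le_Suc_ex[of "Suc k" v] by (auto simp: not_less_eq_eq ac_simps)
    then have "2 * downs a w \<le> w" using v by (intro downs_pyramid_product(1)[OF assms(1)]) simp
    then show ?thesis using assms(2) unfolding w downs_prefix_add by simp
  qed
  then have "degree ?P = length a + k + 1"
    by (subst degree_Cons_Down) auto
  then have "num_small_chains ?P = card (families small_step (length a + k + 1) ?P
      (top_path (length a + k + 1)))"
    unfolding num_small_chains_eq by (simp add: add.commute)
  also have "\<dots> = card (chain_lists (\<preceq>) (k + 1) a (top_path (length a)))"
    by (simp only: card_small_families_eq[OF assms(1)] card_chain_lists_eq_families weakly_below_refl)
  finally show ?thesis by (simp only: conv_power_zeta)
qed

end
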